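(* When the PVCG sharing rule on the supply side is combined with the Crémer–McLean mechanism on the demand side, PVCG maximizes social surplus ex post. That is, the allocation $\bm x^*(\hat{\bm x},\hat{\bm\gamma})$ that the combined mechanism produces from the reports it induces the suppliers to make satisfies, under the true capacity limits $\bar{\bm x}$, cost types $\bm\gamma$ and valuation types $\bm\theta$, for every $\bm x$ with $\bm 0\le\bm x\le\bar{\bm x}$, $$\sum_{j=1}^m v(\bm x^*(\hat{\bm x},\hat{\bm\gamma}),\theta_j)-\sum_{i=1}^n c(x_i^*(\hat{\bm x},\hat{\bm\gamma}),\gamma_i)\ \ge\ \sum_{j=1}^m v(\bm x,\theta_j)-\sum_{i=1}^n c(x_i,\gamma_i).$$
   Context: There are $n$ suppliers $N=\{1,\dots,n\}$ and $m$ consumers; an agent may be both a supplier and a consumer. Supplier $i$ supplies an amount $x_i\ge0$; $\bm x\in\mathbb{R}_{\ge0}^n$ is the procurement level. Supplier $i$ has a true capacity limit $\bar x_i\ge0$ and a true cost type $\gamma_i$ in a set $\Gamma$, both private; its cost of supplying $x_i$ is $c(x_i,\gamma_i)$. Consumer $j$ has valuation type $\theta_j$ and values the virtual good produced from $\bm x$ at $v(\bm x,\theta_j)$. The coordinator's revenue is $r(\bm x)$. The social surplus is the total valuation of consumers minus the total costs of suppliers. For a vector $\bm y$, $\bm y_{-i}$ is $\bm y$ with the $i$th entry removed. Inequalities between vectors are componentwise. Standing assumptions: $r$ is smooth and monotonically increasing (in each coordinate) on $\mathbb{R}_{\ge0}^n$; for each $\gamma\in\Gamma$, $c(\cdot,\gamma)$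 is smooth and monotonically increasing on $\mathbb{R}_{\ge0}$; $r(\bm 0)=0$ and $c(0,\gamma)=0$ for all $\gamma\in\Gamma$; and the Crémer–McLean condition holds: the prior belief about the valuation types $\bm\theta$ is identifiable and correlated. The last assumption guarantees that the Crémer–McLean mechanism, used on the demand side (a Bayesian–Nash incentive-compatible, interim individually rational, ex-post budget-balanced mechanism), extracts the full consumer surplus, so that $r(\bm x)=\sum_{j=1}^m v(\bm x,\theta_j)$. PVCG sharing rule: suppliers report capacity limits $\hat{\bm x}\ge\bm0$ and cost types $\hat{\bm\gamma}\in\Gamma^n$. With $S(\bm x,\bm\gamma)=r(\bm x)-\sum_{i=1}^n c(x_i,\gamma_i)$, the coordinator implements $\bm x^*(\hat{\bm x},\hat{\bm\gamma})$, a (fixed choice of) maximizer of $S(\bm x,\hat{\bm\gamma})$ over $\bm0\le\bm x\le\hat{\bm x}$, and pays supplier $i$ $$p_i(\hat{\bm x},\hat{\bm\gamma})=S(\bm x^*(\hat{\bm x},\hat{\bm\gamma}),\hat{\bm\gamma})+c(x_i^*(\hat{\bm x},\hat{\bm\gamma}),\hat\gamma_i)-h_i(\hat{\bm x}_{-i},\hat{\bm\gamma}_{-i}),$$ where $h_i$ is an arbitrary function. Supplier $i$'s utility is $p_i(\hat{\bm x},\hat{\bm\gamma})-c(x_i^*(\hat{\bm x},\hat{\bm\gamma}),\gamma_i)$. Reports are chosen by the suppliers in response to these payments; truthful reporting is not imposed as a hypothesis, but is the dominant-strategy behaviour that the payment rule is designed to induce (incentive compatibility), and the outcome of the mechanism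 is understood as the outcome of this behaviour. *)

theory Defs
  imports "HOL-Probability.Probability"
begin

section \<open>Smooth functions on sets that need not be open\<close>

fun higher_differentiable_on ::
  "'a::real_normed_vector set \<Rightarrow> ('a \<Rightarrow> 'b::real_normed_vector) \<Rightarrow> nat \<Rightarrow> bool" where
  "higher_differentiable_on U f 0 \<longleftrightarrow> continuous_on U f"
| "higher_differentiable_on U f (Suc k) \<longleftrightarrow>
     (\<forall>x\<in>U. f differentiable (at x)) \<and>
     (\<forall>d. higher_differentiable_on U (\<lambda>x. frechet_derivative f (at x) d) k)"

text \<open>On a set such as the closed orthant, smoothness means having a smooth extension to an
  open neighbourhood.\<close>

definition smooth_on :: "'a::real_normed_vector set \<Rightarrow> ('a \<Rightarrow> 'b::real_normed_vector) \<Rightarrow> bool" where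
  "smooth_on A f \<longleftrightarrow>
     (\<exists>U g. open U \<and> A \<subseteq> U \<and> (\<forall>k. higher_differentiable_on U g k) \<and> (\<forall>x\<in>A. g x = f x))"


section \<open>Demand side\<close>

text \<open>The prior is a distribution over profiles of valuation types. The type space of consumer
  \<open>j\<close> consists of the types of positive marginal probability. A profile with the \<open>j\<close>th entry
  removed is represented by the function restricted to \<open>- {j}\<close>, which is \<open>undefined\<close> at \<open>j\<close>, so
  that \<open>\<phi>(j := a)\<close> puts an entry back.\<close>

definition val_types :: "('m \<Rightarrow> 't) pmf \<Rightarrow> 'm \<Rightarrow> 't set" where
  "val_types p j = (\<lambda>\<theta>. \<theta> j) ` set_pmf p"

definition val_profiles :: "('m \<Rightarrow> 't) pmf \<Rightarrow> ('m \<Rightarrow> 't) set" where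
  "val_profiles p = {\<theta>. \<forall>j. \<theta> j \<in> val_types p j}"

definition belief :: "('m \<Rightarrow> 't) pmf \<Rightarrow> 'm \<Rightarrow> 't \<Rightarrow> ('m \<Rightarrow> 't) pmf" where
  "belief p j a = map_pmf (\<lambda>\<theta>. restrict \<theta> (- {j})) (cond_pmf p {\<theta>. \<theta> j = a})"

text \<open>The two conditions of Kosenok and Severinov (J. Econ. Theory 140, 2008) on the prior.
  Correlation is the condition of Cremer and McLean: no type's belief about the others is a
  nonnegative combination of the beliefs of the remaining types of the same consumer.
  Identifiability: no other distribution has all its conditional distributions in the cones
  spanned by the beliefs derived from the prior.\<close>

definition correlated :: "('m \<Rightarrow> 't) pmf \<Rightarrow> bool" where
  "correlated p \<longleftrightarrow>
     (\<forall>j. \<forall>a\<in>val_types p j. \<not> (\<exists>w. (\<forall>b. 0 \<le> w b) \<and>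
        (\<forall>\<phi>. pmf (belief p j a) \<phi> = (\<Sum>b\<in>val_types p j - {a}. w b * pmf (belief p j b) \<phi>))))"

definition identifiable :: "('m \<Rightarrow> 't) pmf \<Rightarrow> bool" where
  "identifiable p \<longleftrightarrow>
     (\<forall>q. set_pmf q \<subseteq> val_profiles p \<and> q \<noteq> p \<longrightarrow>
        (\<exists>j. \<exists>a\<in>val_types q j. \<not> (\<exists>w. (\<forall>b. 0 \<le> w b) \<and>
          (\<forall>\<phi>. pmf (belief q j a) \<phi> = (\<Sum>b\<in>val_types p j. w b * pmf (belief p j b) \<phi>)))))"

definition cremer_mclean_condition :: "('m \<Rightarrow> 't) pmf \<Rightarrow> bool" where
  "cremer_mclean_condition p \<longleftrightarrow> finite (set_pmf p) \<and> identifiable p \<and> correlated p"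

text \<open>\<open>t x \<theta> j\<close> is the payment of consumer \<open>j\<close> at procurement level \<open>x\<close> and reported profile
  \<open>\<theta>\<close>; \<open>R x \<theta>\<close> is the coordinator's revenue. A deviating consumer of type \<open>a\<close> reports \<open>b\<close>.\<close>

definition bayesian_incentive_compatible ::
  "('m \<Rightarrow> 't) pmf \<Rightarrow> (real^'n \<Rightarrow> 't \<Rightarrow> real) \<Rightarrow> (real^'n \<Rightarrow> ('m \<Rightarrow> 't) \<Rightarrow> 'm \<Rightarrow> real) \<Rightarrow> bool" where
  "bayesian_incentive_compatible p v t \<longleftrightarrow>
     (\<forall>x\<ge>0. \<forall>j. \<forall>a\<in>val_types p j. \<forall>b\<in>val_types p j.
        measure_pmf.expectation (belief p j a) (\<lambda>\<phi>. v x a - t x (\<phi>(j := b)) j)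
          \<le> measure_pmf.expectation (belief p j a) (\<lambda>\<phi>. v x a - t x (\<phi>(j := a)) j))"

definition interim_individually_rational ::
  "('m \<Rightarrow> 't) pmf \<Rightarrow> (real^'n \<Rightarrow> 't \<Rightarrow> real) \<Rightarrow> (real^'n \<Rightarrow> ('m \<Rightarrow> 't) \<Rightarrow> 'm \<Rightarrow> real) \<Rightarrow> bool" where
  "interim_individually_rational p v t \<longleftrightarrow>
     (\<forall>x\<ge>0. \<forall>j. \<forall>a\<in>val_types p j.
        0 \<le> measure_pmf.expectation (belief p j a) (\<lambda>\<phi>. v x a - t x (\<phi>(j := a)) j))"

definition ex_post_budget_balanced ::
  "('m::finite \<Rightarrow> 't) pmf \<Rightarrow> (real^'n \<Rightarrow> ('m \<Rightarrow> 't) \<Rightarrow> 'm \<Rightarrow> real) \<Rightarrow>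
    (real^'n \<Rightarrow> ('m \<Rightarrow> 't) \<Rightarrow> real) \<Rightarrow> bool" where
  "ex_post_budget_balanced p t R \<longleftrightarrow>
     (\<forall>x\<ge>0. \<forall>\<theta>\<in>val_profiles p. R x \<theta> = (\<Sum>j\<in>UNIV. t x \<theta> j))"

definition extracts_full_surplus ::
  "('m::finite \<Rightarrow> 't) pmf \<Rightarrow> (real^'n \<Rightarrow> 't \<Rightarrow> real) \<Rightarrow>
    (real^'n \<Rightarrow> ('m \<Rightarrow> 't) \<Rightarrow> 'm \<Rightarrow> real) \<Rightarrow> bool" where
  "extracts_full_surplus p v t \<longleftrightarrow>
     (\<forall>x\<ge>0. \<forall>\<theta>\<in>val_profiles p. (\<Sum>j\<in>UNIV. t x \<theta> j) = (\<Sum>j\<in>UNIV. v x (\<theta> j)))"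

definition cremer_mclean_mechanism ::
  "('m::finite \<Rightarrow> 't) pmf \<Rightarrow> (real^'n \<Rightarrow> 't \<Rightarrow> real) \<Rightarrow>
    (real^'n \<Rightarrow> ('m \<Rightarrow> 't) \<Rightarrow> 'm \<Rightarrow> real) \<Rightarrow> (real^'n \<Rightarrow> ('m \<Rightarrow> 't) \<Rightarrow> real) \<Rightarrow> bool" where
  "cremer_mclean_mechanism p v t R \<longleftrightarrow>
     bayesian_incentive_compatible p v t \<and> interim_individually_rational p v t \<and>
     ex_post_budget_balanced p t R \<and> extracts_full_surplus p v t"


section \<open>Supply side\<close>

definition procurement_box :: "real^'n \<Rightarrow> (real^'n) set" where
  "procurement_box u = {x. 0 \<le> x \<and> x \<le> u}"

definition remove_entry :: "'n \<Rightarrow> 'a^'n \<Rightarrow> 'n \<Rightarrow> 'a" where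
  "remove_entry i y = restrict (($) y) (- {i})"

definition set_entry :: "'a^'n \<Rightarrow> 'n \<Rightarrow> 'a \<Rightarrow> 'a^'n" where
  "set_entry y i a = (\<chi> k. if k = i then a else y $ k)"

definition S_fun :: "(real^'n \<Rightarrow> real) \<Rightarrow> (real \<Rightarrow> 'g \<Rightarrow> real) \<Rightarrow> real^'n \<Rightarrow> 'g^'n \<Rightarrow> real" where
  "S_fun r c x g = r x - (\<Sum>i\<in>UNIV. c (x $ i) (g $ i))"

definition valid_reports :: "'g set \<Rightarrow> real^'n \<Rightarrow> 'g^'n \<Rightarrow> bool" where
  "valid_reports \<Gamma> xh gh \<longleftrightarrow> 0 \<le> xh \<and> (\<forall>i. gh $ i \<in> \<Gamma>)"

definition allocation_rule ::
  "(real^'n \<Rightarrow> real) \<Rightarrow> (real \<Rightarrow> 'g \<Rightarrow> real) \<Rightarrow> 'g set \<Rightarrow> (real^'n \<Rightarrow> 'g^'n \<Rightarrow> real^'n) \<Rightarrow> bool" where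
  "allocation_rule r c \<Gamma> xs \<longleftrightarrow>
     (\<forall>xh gh. valid_reports \<Gamma> xh gh \<longrightarrow>
        is_arg_max (\<lambda>x. S_fun r c x gh) (\<lambda>x. x \<in> procurement_box xh) (xs xh gh))"

definition pvcg_payment ::
  "(real^'n \<Rightarrow> real) \<Rightarrow> (real \<Rightarrow> 'g \<Rightarrow> real) \<Rightarrow> (real^'n \<Rightarrow> 'g^'n \<Rightarrow> real^'n) \<Rightarrow>
    ('n \<Rightarrow> ('n \<Rightarrow> real) \<Rightarrow> ('n \<Rightarrow> 'g) \<Rightarrow> real) \<Rightarrow> 'n \<Rightarrow> real^'n \<Rightarrow> 'g^'n \<Rightarrow> real" where
  "pvcg_payment r c xs h i xh gh =
     S_fun r c (xs xh gh) gh + c (xs xh gh $ i) (gh $ i)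
       - h i (remove_entry i xh) (remove_entry i gh)"

definition supplier_utility ::
  "(real^'n \<Rightarrow> real) \<Rightarrow> (real \<Rightarrow> 'g \<Rightarrow> real) \<Rightarrow> (real^'n \<Rightarrow> 'g^'n \<Rightarrow> real^'n) \<Rightarrow>
    ('n \<Rightarrow> ('n \<Rightarrow> real) \<Rightarrow> ('n \<Rightarrow> 'g) \<Rightarrow> real) \<Rightarrow> 'n \<Rightarrow> 'g \<Rightarrow> real^'n \<Rightarrow> 'g^'n \<Rightarrow> real" where
  "supplier_utility r c xs h i \<gamma>i xh gh = pvcg_payment r c xs h i xh gh - c (xs xh gh $ i) \<gamma>i"

text \<open>The report \<open>(a, g)\<close> is weakly dominant for supplier \<open>i\<close> with true capacity \<open>xi\<close> and true
  cost type \<open>\<gamma>i\<close>: it is a best response to all reports of the others (\<open>xh\<close> and \<open>gh\<close> without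
  their \<open>i\<close>th entries). Any nonnegative capacity may be reported, but a supplier physically cannot
  deliver more than its capacity, so only reports leading to an assignment of at most \<open>xi\<close>
  compete; without this proviso overstating the capacity would pay.\<close>

definition dominant_report ::
  "(real^'n \<Rightarrow> real) \<Rightarrow> (real \<Rightarrow> 'g \<Rightarrow> real) \<Rightarrow> 'g set \<Rightarrow> (real^'n \<Rightarrow> 'g^'n \<Rightarrow> real^'n) \<Rightarrow>
    ('n \<Rightarrow> ('n \<Rightarrow> real) \<Rightarrow> ('n \<Rightarrow> 'g) \<Rightarrow> real) \<Rightarrow> 'n \<Rightarrow> real \<Rightarrow> 'g \<Rightarrow> real \<Rightarrow> 'g \<Rightarrow> bool" where
  "dominant_report r c \<Gamma> xs h i xi \<gamma>i a g \<longleftrightarrow>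
     0 \<le> a \<and> g \<in> \<Gamma> \<and>
     (\<forall>xh gh. valid_reports \<Gamma> xh gh \<longrightarrow>
        xs (set_entry xh i a) (set_entry gh i g) $ i \<le> xi \<and>
        (\<forall>a' g'. 0 \<le> a' \<and> g' \<in> \<Gamma> \<and> xs (set_entry xh i a') (set_entry gh i g') $ i \<le> xi \<longrightarrow>
           supplier_utility r c xs h i \<gamma>i (set_entry xh i a') (set_entry gh i g')
             \<le> supplier_utility r c xs h i \<gamma>i (set_entry xh i a) (set_entry gh i g)))"

definition induced_reports ::
  "(real^'n \<Rightarrow> real) \<Rightarrow> (real \<Rightarrow> 'g \<Rightarrow> real) \<Rightarrow> 'g set \<Rightarrow> (real^'n \<Rightarrow> 'g^'n \<Rightarrow> real^'n) \<Rightarrow>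
    ('n \<Rightarrow> ('n \<Rightarrow> real) \<Rightarrow> ('n \<Rightarrow> 'g) \<Rightarrow> real) \<Rightarrow> real^'n \<Rightarrow> 'g^'n \<Rightarrow> real^'n \<Rightarrow> 'g^'n \<Rightarrow> bool" where
  "induced_reports r c \<Gamma> xs h xbar \<gamma> xh gh \<longleftrightarrow>
     (\<forall>i. dominant_report r c \<Gamma> xs h i (xbar $ i) (\<gamma> $ i) (xh $ i) (gh $ i))"

definition social_surplus ::
  "(real^'n \<Rightarrow> 't \<Rightarrow> real) \<Rightarrow> (real \<Rightarrow> 'g \<Rightarrow> real) \<Rightarrow> ('m::finite \<Rightarrow> 't) \<Rightarrow> 'g^'n \<Rightarrow> real^'n \<Rightarrow> real"
where
  "social_surplus v c \<theta> \<gamma> x =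
     (\<Sum>j\<in>UNIV. v x (\<theta> j)) - (\<Sum>i\<in>UNIV. c (x $ i) (\<gamma> $ i))"

end

theory Submission
  imports Defs
begin

text \<open>Truthful reporting is dominant by the usual VCG argument, since the utility of a supplier
  is the surplus computed with its true cost, up to a term that it cannot influence. Other reports
  may be dominant too. Such a report of supplier \<open>i\<close> must, whatever the others report, lead to a
  common maximizer of the reported and of the true problem of \<open>i\<close>. By the envelope theorem, the
  difference of the two maximal values then does not change when the capacities of the others are
  scaled down to zero, so it is a constant \<open>K\<^sub>i\<close> independent of the others' reports; it is also the
  amount by which \<open>i\<close>'s reported cost at the chosen allocation exceeds the true one. Replacing
  the true data by the reports one supplier at a time changes the maximal surplus by \<open>\<Sum>i. K\<^sub>i\<close>
  in total, which is exactly the total misreported cost at the chosen allocation.\<close>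

section \<open>Continuous differentiability on sets that need not be open\<close>

definition C1_on :: "'a::euclidean_space set \<Rightarrow> ('a \<Rightarrow> real) \<Rightarrow> bool" where
  "C1_on A f \<longleftrightarrow>
     (\<exists>G. continuous_on A G \<and> (\<forall>x\<in>A. (f has_derivative (\<lambda>d. G x \<bullet> d)) (at x within A)))"

text \<open>The gradient is assembled from the partial derivatives of the smooth extension, whose
  continuity is order one of \<open>higher_differentiable_on\<close>.\<close>

lemma smooth_on_imp_C1_on:
  fixes f :: "'a::euclidean_space \<Rightarrow> real"
  assumes "smooth_on A f"
  shows "C1_on A f"
proof -
  obtain U g where U: "A \<subseteq> U" "\<And>k. higher_differentiable_on U g k" "\<And>x. x \<in> A \<Longrightarrow> g x = f x"
    using assms unfolding smooth_on_def by blast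
  have diff: "g differentiable (at x)" if "x \<in> U" for x
    using U(2)[of "Suc 0"] that by simp
  have cont: "continuous_on U (\<lambda>x. frechet_derivative g (at x) d)" for d
    using U(2)[of "Suc 0"] by simp
  define G where "G = (\<lambda>x. \<Sum>b\<in>Basis. frechet_derivative g (at x) b *\<^sub>R b)"
  have "continuous_on A G"
    unfolding G_def by (intro continuous_intros continuous_on_subset[OF cont U(1)])
  moreover have "(f has_derivative (\<lambda>d. G x \<bullet> d)) (at x within A)" if x: "x \<in> A" for x
  proof -
    have der: "(g has_derivative frechet_derivative g (at x)) (at x)"
      using diff x U(1) frechet_derivative_works by blast
    then have lin: "linear (frechet_derivative g (at x))"
      by (rule has_derivative_linear)
    have "frechet_derivative g (at x) d = G x \<bullet> d" for d
    proof -
      have "frechet_derivative g (at x) d = frechet_derivative g (at x) (\<Sum>b\<in>Basis. (d \<bullet> b) *\<^sub>R b)"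
        by (simp add: euclidean_representation)
      also have "\<dots> = (\<Sum>b\<in>Basis. (d \<bullet> b) * frechet_derivative g (at x) b)"
        using lin by (simp add: linear_sum linear_cmul)
      also have "\<dots> = G x \<bullet> d"
        unfolding G_def inner_sum_left by (intro sum.cong) (auto simp: inner_commute)
      finally show ?thesis .
    qed
    then have "(g has_derivative (\<lambda>d. G x \<bullet> d)) (at x)"
      using der by presburger
    \<comment> \<open>The restriction to \<open>A\<close> precedes the passage from \<open>g\<close>
      to \<open>f\<close>, since the two are only known to agree on \<open>A\<close>.\<close>
    then have "(g has_derivative (\<lambda>d. G x \<bullet> d)) (at x within A)"
      by (rule has_derivative_at_withinI)
    then show ?thesis
      by (rule has_derivative_transform[rotated -1]) (use x U(3) in auto)
  qed
  ultimately show ?thesis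
    unfolding C1_on_def by blast
qed

lemma C1_on_diff:
  assumes "C1_on A f" "C1_on A g"
  shows "C1_on A (\<lambda>x. f x - g x)"
proof -
  obtain F G where F: "continuous_on A F" "\<forall>x\<in>A. (f has_derivative (\<lambda>d. F x \<bullet> d)) (at x within A)"
    and G: "continuous_on A G" "\<forall>x\<in>A. (g has_derivative (\<lambda>d. G x \<bullet> d)) (at x within A)"
    using assms unfolding C1_on_def by blast
  then have "\<forall>x\<in>A. ((\<lambda>x. f x - g x) has_derivative (\<lambda>d. (F x - G x) \<bullet> d)) (at x within A)"
    by (simp add: inner_diff_left has_derivative_diff)
  then show ?thesis
    unfolding C1_on_def using continuous_on_diff[OF F(1) G(1)] by blast
qed

lemma C1_on_sum:
  assumes "\<And>k. k \<in> I \<Longrightarrow> C1_on A (f k)"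
  shows "C1_on A (\<lambda>x. \<Sum>k\<in>I. f k x)"
proof -
  obtain G where G: "\<And>k. k \<in> I \<Longrightarrow> continuous_on A (G k)"
    "\<And>k x. k \<in> I \<Longrightarrow> x \<in> A \<Longrightarrow> (f k has_derivative (\<lambda>d. G k x \<bullet> d)) (at x within A)"
    using assms unfolding C1_on_def by metis
  then have "\<forall>x\<in>A. ((\<lambda>x. \<Sum>k\<in>I. f k x) has_derivative (\<lambda>d. (\<Sum>k\<in>I. G k x) \<bullet> d)) (at x within A)"
    by (auto simp: inner_sum_left intro!: has_derivative_sum)
  moreover have "continuous_on A (\<lambda>x. \<Sum>k\<in>I. G k x)"
    using G(1) by (intro continuous_on_sum)
  ultimately show ?thesis
    unfolding C1_on_def by blast
qed

lemma C1_on_component: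
  fixes f :: "real \<Rightarrow> real" and k :: "'n::finite"
  assumes "C1_on B f" "(\<lambda>x. x $ k) ` A \<subseteq> B"
  shows "C1_on A (\<lambda>x::real^'n. f (x $ k))"
proof -
  obtain F where F: "continuous_on B F" "\<And>x. x \<in> B \<Longrightarrow> (f has_derivative (\<lambda>d. F x \<bullet> d)) (at x within B)"
    using assms(1) unfolding C1_on_def by blast
  have "((\<lambda>x. f (x $ k)) has_derivative (\<lambda>d. (F (x $ k) *\<^sub>R axis k 1) \<bullet> d)) (at x within A)" if "x \<in> A" for x
  proof -
    have "((\<lambda>x. x $ k) has_derivative (\<lambda>d. d $ k)) (at x within A)"
      by (rule bounded_linear_imp_has_derivative[OF bounded_linear_vec_nth])
    moreover have "(f has_derivative (\<lambda>d. F (x $ k) \<bullet> d)) (at (x $ k) within (\<lambda>x. x $ k) ` A)"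
      by (rule has_derivative_subset[OF F(2) assms(2)]) (use assms(2) that in blast)
    ultimately have "((\<lambda>x. f (x $ k)) has_derivative (\<lambda>d. F (x $ k) \<bullet> (d $ k))) (at x within A)"
      by (rule has_derivative_in_compose)
    then show ?thesis
      by (simp add: inner_axis')
  qed
  moreover have "continuous_on A (\<lambda>x. F (x $ k) *\<^sub>R axis k (1::real))"
    by (intro continuous_on_scaleR continuous_on_const continuous_on_compose2[OF F(1) _ assms(2)]
        continuous_on_component continuous_on_id)
  ultimately show ?thesis
    unfolding C1_on_def by blast
qed

text \<open>Chain rule along segments. Joint continuity in \<open>(u, s)\<close> yields a uniform
  modulus over a compact \<open>K\<close> in the envelope argument.\<close>

lemma C1_on_orthant_line:
  fixes f :: "real^'n \<Rightarrow> real" and P Q :: "'a::topological_space \<Rightarrow> real^'n"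
  assumes "C1_on {x. 0 \<le> x} f" "continuous_on K P" "continuous_on K Q"
    and nonneg: "\<And>u s. u \<in> K \<Longrightarrow> s \<in> {0..1} \<Longrightarrow> 0 \<le> P u + s *\<^sub>R Q u"
  obtains F' where "continuous_on (K \<times> {0..1}) (\<lambda>z. F' (fst z) (snd z))"
    "\<And>u s. u \<in> K \<Longrightarrow> s \<in> {0..1} \<Longrightarrow>
       ((\<lambda>s. f (P u + s *\<^sub>R Q u)) has_real_derivative F' u s) (at s within {0..1})"
proof -
  obtain G where G: "continuous_on {x. 0 \<le> x} G"
    "\<And>x. 0 \<le> x \<Longrightarrow> (f has_derivative (\<lambda>d. G x \<bullet> d)) (at x within {x. 0 \<le> x})"
    using assms(1) unfolding C1_on_def by blast
  define F' where "F' = (\<lambda>u s. G (P u + s *\<^sub>R Q u) \<bullet> Q u)"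
  have P': "continuous_on (K \<times> {0..1::real}) (\<lambda>z. P (fst z))"
    by (rule continuous_on_compose2[OF assms(2)]) (auto intro!: continuous_intros)
  have Q': "continuous_on (K \<times> {0..1::real}) (\<lambda>z. Q (fst z))"
    by (rule continuous_on_compose2[OF assms(3)]) (auto intro!: continuous_intros)
  have "continuous_on (K \<times> {0..1}) (\<lambda>z. G (P (fst z) + snd z *\<^sub>R Q (fst z)))"
    by (rule continuous_on_compose2[OF G(1)]) (use nonneg in \<open>auto intro!: continuous_intros P' Q'\<close>)
  then have "continuous_on (K \<times> {0..1}) (\<lambda>z. F' (fst z) (snd z))"
    unfolding F'_def by (intro continuous_intros Q')
  moreover have "((\<lambda>s. f (P u + s *\<^sub>R Q u)) has_real_derivative F' u s) (at s within {0..1})"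
    if "u \<in> K" "s \<in> {0..1}" for u s
  proof -
    have 1: "((\<lambda>s. P u + s *\<^sub>R Q u) has_derivative (\<lambda>h. h *\<^sub>R Q u)) (at s within {0..1})"
      by (auto intro!: derivative_eq_intros)
    have 2: "(f has_derivative (\<lambda>d. G (P u + s *\<^sub>R Q u) \<bullet> d))
        (at (P u + s *\<^sub>R Q u) within (\<lambda>s. P u + s *\<^sub>R Q u) ` {0..1})"
      by (rule has_derivative_subset[OF G(2)]) (use nonneg that in auto)
    show ?thesis
      using has_derivative_in_compose[OF 1 2]
      by (simp add: has_field_derivative_def F'_def mult.commute[of _ "_ \<bullet> _"])
  qed
  ultimately show ?thesis
    using that by blast
qed

section \<open>An envelope argument for two value functions\<close>

text \<open>Integral-free form of the envelope theorem: at every \<open>s\<close> the two maximization problems with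
  values \<open>V\<close> and \<open>W\<close> share a maximizer \<open>y s\<close> and have the same \<open>s\<close>-dependent part \<open>F\<close>. With
  \<open>p s = F' (y s) s\<close>, the change of \<open>V - W\<close> over a short interval is at most its length times
  \<open>\<Delta>p + 2\<epsilon>\<close>. Over a uniform partition the \<open>\<Delta>p\<close> telescope, so refining it gives zero.\<close>

lemma envelope_difference_constant:
  fixes F F' :: "'a::metric_space \<Rightarrow> real \<Rightarrow> real" and V W :: "real \<Rightarrow> real"
  assumes K: "compact K"
    and cont: "continuous_on (K \<times> {0..1}) (\<lambda>z. F' (fst z) (snd z))"
    and der: "\<And>u s. u \<in> K \<Longrightarrow> s \<in> {0..1} \<Longrightarrow> (F u has_real_derivative F' u s) (at s within {0..1})"
    and y: "\<And>s. s \<in> {0..1} \<Longrightarrow> y s \<in> K"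
    and V: "\<And>s s'. s \<in> {0..1} \<Longrightarrow> s' \<in> {0..1} \<Longrightarrow> V s + F (y s) s' - F (y s) s \<le> V s'"
    and W: "\<And>s s'. s \<in> {0..1} \<Longrightarrow> s' \<in> {0..1} \<Longrightarrow> W s + F (y s) s' - F (y s) s \<le> W s'"
  shows "V 1 - W 1 = V 0 - W 0"
proof -
  define D where "D = (\<lambda>s. V s - W s)"
  define p where "p = (\<lambda>s. F' (y s) s)"
  have mean: "\<exists>\<sigma>\<in>{s..s'}. F u s' - F u s = (s' - s) * F' u \<sigma>"
    if "u \<in> K" "0 \<le> s" "s < s'" "s' \<le> 1" for u s s'
  proof -
    have "\<exists>\<sigma>\<in>{s<..<s'}. F u s' - F u s = (\<lambda>h. F' u \<sigma> * h) (s' - s)"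
    proof (rule mvt_simple[OF that(3)])
      fix x assume "s \<le> x" "x \<le> s'"
      then have "(F u has_real_derivative F' u x) (at x within {s..s'})"
        using der[of u x] that by (auto intro: DERIV_subset)
      then show "(F u has_derivative (*) (F' u x)) (at x within {s..s'})"
        by (simp add: has_field_derivative_def)
    qed
    then obtain \<sigma> where "\<sigma> \<in> {s<..<s'}" "F u s' - F u s = F' u \<sigma> * (s' - s)"
      by blast
    then show ?thesis
      by (intro bexI[of _ \<sigma>]) auto
  qed
  have "\<bar>D 1 - D 0\<bar> \<le> e" if e: "0 < e" for e
  proof -
    have "uniformly_continuous_on (K \<times> {0..1}) (\<lambda>z. F' (fst z) (snd z))"
      using cont K by (intro compact_uniformly_continuous compact_Times) auto
    \<comment> \<open>One \<open>e / 4\<close> is spent at each end of a short interval, which makes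
      the \<open>e / 2\<close> in \<open>step\<close>.\<close>
    then obtain d where d: "d > 0" "\<And>z z'. z \<in> K \<times> {0..1} \<Longrightarrow> z' \<in> K \<times> {0..1} \<Longrightarrow> dist z' z < d \<Longrightarrow>
        dist (F' (fst z') (snd z')) (F' (fst z) (snd z)) < e / 4"
      unfolding uniformly_continuous_on_def using e by (metis divide_pos_pos zero_less_numeral)
    have close: "\<bar>F' u \<sigma> - F' u s\<bar> < e / 4"
      if "u \<in> K" "s \<in> {0..1}" "\<sigma> \<in> {0..1}" "\<bar>\<sigma> - s\<bar> < d" for u s \<sigma>
      using d(2)[of "(u, s)" "(u, \<sigma>)"] that by (simp add: dist_Pair_Pair dist_real_def)
    have step: "\<bar>D s' - D s\<bar> \<le> (s' - s) * (p s' - p s + e / 2)"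
      if s: "0 \<le> s" "s < s'" "s' \<le> 1" "s' - s < d" for s s'
    proof -
      have in01: "s \<in> {0..1}" "s' \<in> {0..1}"
        using s by auto
      obtain \<sigma> where \<sigma>: "\<sigma> \<in> {s..s'}" "F (y s') s' - F (y s') s = (s' - s) * F' (y s') \<sigma>"
        using mean[OF y[OF in01(2)] s(1-3)] by blast
      obtain \<tau> where \<tau>: "\<tau> \<in> {s..s'}" "F (y s) s' - F (y s) s = (s' - s) * F' (y s) \<tau>"
        using mean[OF y[OF in01(1)] s(1-3)] by blast
      \<comment> \<open>The assumptions on \<open>V\<close> and \<open>W\<close>, used in both
        directions, place \<open>V s' - V s\<close> and \<open>W s' - W s\<close> between the
        increments of \<open>F (y s)\<close> and of \<open>F (y s')\<close>; so they differ by at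
        most the gap between these.\<close>
      have "\<bar>D s' - D s\<bar> \<le> (F (y s') s' - F (y s') s) - (F (y s) s' - F (y s) s)"
        using V[OF in01] V[OF in01(2,1)] W[OF in01] W[OF in01(2,1)] unfolding D_def by linarith
      also have "\<dots> = (s' - s) * (F' (y s') \<sigma> - F' (y s) \<tau>)"
        using \<sigma>(2) \<tau>(2) by (simp add: algebra_simps)
      also have "\<dots> \<le> (s' - s) * (p s' - p s + e / 2)"
      proof (intro mult_left_mono)
        have "\<bar>F' (y s') \<sigma> - F' (y s') s'\<bar> < e / 4"
          using s \<sigma>(1) in01 by (intro close y) auto
        moreover have "\<bar>F' (y s) \<tau> - F' (y s) s\<bar> < e / 4"
          using s \<tau>(1) in01 by (intro close y) auto
        ultimately show "F' (y s') \<sigma> - F' (y s) \<tau> \<le> p s' - p s + e / 2"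
          unfolding p_def by linarith
      qed (use s in auto)
      finally show ?thesis .
    qed
    \<comment> \<open>The mesh \<open>1 / N\<close> falls below \<open>d\<close>, and the telescoped
      term \<open>(p 1 - p 0) / N\<close> is at most \<open>e / 2\<close>.\<close>
    obtain N :: nat where N: "real N > max (1 / d) (2 * (p 1 - p 0) / e)"
      using reals_Archimedean2 by blast
    then have Npos: "real N > 0"
      using d(1) by (smt (verit) divide_pos_pos max.bounded_iff)
    have Nd: "1 / real N < d"
      using N d(1) Npos by (simp add: field_simps)
    have Np: "(p 1 - p 0) / real N \<le> e / 2"
      using N e Npos by (simp add: field_simps)
    have "\<bar>D (k / N) - D 0\<bar> \<le> (p (k / N) - p 0 + k * (e / 2)) / N" if "k \<le> N" for k
      using that
    proof (induction k)
      case 0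
      then show ?case by simp
    next
      case (Suc k)
      have "\<bar>D (Suc k / N) - D (k / N)\<bar>
          \<le> (Suc k / N - k / N) * (p (Suc k / N) - p (k / N) + e / 2)"
        using Suc.prems Npos Nd by (intro step) (auto simp: field_simps)
      also have "\<dots> = (p (Suc k / N) - p (k / N) + e / 2) / N"
        using Npos by (simp add: field_simps)
      finally have "\<bar>D (Suc k / N) - D 0\<bar>
          \<le> (p (Suc k / N) - p (k / N) + e / 2) / N + (p (k / N) - p 0 + k * (e / 2)) / N"
        using Suc by linarith
      also have "\<dots> = (p (Suc k / N) - p 0 + Suc k * (e / 2)) / N"
        by (simp add: add_divide_distrib diff_divide_distrib algebra_simps)
      finally show ?case .
    qed
    from this[of N] have "\<bar>D 1 - D 0\<bar> \<le> (p 1 - p 0) / N + e / 2"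
      using Npos by (simp add: add_divide_distrib)
    then show ?thesis
      using Np by linarith
  qed
  then have "\<bar>D 1 - D 0\<bar> \<le> 0"
    by (rule field_le_epsilon[where y = 0, simplified])
  then show ?thesis
    unfolding D_def by simp
qed

section \<open>Changing the report of a single supplier\<close>

lemma set_entry_nth [simp]: "set_entry y i a $ k = (if k = i then a else y $ k)"
  by (simp add: set_entry_def)

lemma set_entry_same [simp]: "set_entry y i (y $ i) = y"
  by (simp add: vec_eq_iff)

lemma remove_entry_set_entry [simp]: "remove_entry i (set_entry y i a) = remove_entry i y"
  by (simp add: remove_entry_def restrict_def fun_eq_iff)

lemma procurement_box_nth:
  assumes "x \<in> procurement_box u"
  shows "0 \<le> x $ k" "x $ k \<le> u $ k"
  using assms by (auto simp: procurement_box_def less_eq_vec_def)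

text \<open>The type of \<open>i\<close> enters only the last term, so changing it shifts the
  surplus by a difference of costs of \<open>i\<close> at \<open>x\<close>.\<close>

lemma S_fun_set_entry:
  "S_fun r c x (set_entry gh i g) = r x - (\<Sum>k\<in>-{i}. c (x $ k) (gh $ k)) - c (x $ i) g"
proof -
  have "(\<Sum>k\<in>UNIV. c (x $ k) (set_entry gh i g $ k))
      = c (x $ i) g + (\<Sum>k\<in>UNIV - {i}. c (x $ k) (set_entry gh i g $ k))"
    by (subst sum.remove[of _ i]) auto
  also have "(\<Sum>k\<in>UNIV - {i}. c (x $ k) (set_entry gh i g $ k)) = (\<Sum>k\<in>-{i}. c (x $ k) (gh $ k))"
    by (intro sum.cong) auto
  finally show ?thesis
    by (simp add: S_fun_def)
qed

section \<open>Surplus and dominance for one supplier\<close>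

locale procurement =
  fixes r :: "real^'n \<Rightarrow> real" and c :: "real \<Rightarrow> 'g \<Rightarrow> real" and \<Gamma> :: "'g set"
    and xs :: "real^'n \<Rightarrow> 'g^'n \<Rightarrow> real^'n"
  assumes r_C1: "C1_on {x. 0 \<le> x} r"
    and c_C1: "g \<in> \<Gamma> \<Longrightarrow> C1_on {0..} (\<lambda>y. c y g)"
    and c_zero: "g \<in> \<Gamma> \<Longrightarrow> c 0 g = 0"
    and allocation: "allocation_rule r c \<Gamma> xs"
begin

definition max_surplus :: "real^'n \<Rightarrow> 'g^'n \<Rightarrow> real" where
  "max_surplus xh gh = S_fun r c (xs xh gh) gh"

lemma xs_in_box: "valid_reports \<Gamma> xh gh \<Longrightarrow> xs xh gh \<in> procurement_box xh"
  using allocation unfolding allocation_rule_def is_arg_max_linorder by blast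

lemma S_fun_le_max_surplus:
  "valid_reports \<Gamma> xh gh \<Longrightarrow> x \<in> procurement_box xh \<Longrightarrow> S_fun r c x gh \<le> max_surplus xh gh"
  using allocation unfolding allocation_rule_def is_arg_max_linorder max_surplus_def by blast

lemma valid_set_entry:
  "valid_reports \<Gamma> xh gh \<Longrightarrow> 0 \<le> a \<Longrightarrow> g \<in> \<Gamma> \<Longrightarrow> valid_reports \<Gamma> (set_entry xh i a) (set_entry gh i g)"
  by (auto simp: valid_reports_def less_eq_vec_def)

text \<open>The VCG identity: the payment adds back the reported cost of \<open>i\<close>, so
  subtracting the true cost leaves the surplus at the true type. The \<open>h\<close> term does not
  see the report of \<open>i\<close>.\<close>

lemma supplier_utility_set_entry:
  "supplier_utility r c xs h i \<gamma>i (set_entry xh i a) (set_entry gh i g)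
     = S_fun r c (xs (set_entry xh i a) (set_entry gh i g)) (set_entry gh i \<gamma>i)
       - h i (remove_entry i xh) (remove_entry i gh)"
  by (simp add: supplier_utility_def pvcg_payment_def S_fun_set_entry)

text \<open>Makes every competing report comparable with truth: its allocation is feasible at the
  true capacity \<open>xi\<close>.\<close>

lemma deliverable_in_box:
  assumes "valid_reports \<Gamma> xh gh" "0 \<le> a" "g \<in> \<Gamma>"
    and "xs (set_entry xh i a) (set_entry gh i g) $ i \<le> xi"
  shows "xs (set_entry xh i a) (set_entry gh i g) \<in> procurement_box (set_entry xh i xi)"
  using xs_in_box[OF valid_set_entry[OF assms(1-3), of i]] assms(4)
  by (auto simp: procurement_box_def less_eq_vec_def split: if_splits)

text \<open>Up to the \<open>h\<close> term, any deliverable report earns the true surplus at a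
  point of the true box, and truth makes the coordinator maximize exactly that.\<close>

lemma truthful_dominant:
  assumes "0 \<le> xi" "\<gamma>i \<in> \<Gamma>"
  shows "dominant_report r c \<Gamma> xs h i xi \<gamma>i xi \<gamma>i"
  unfolding dominant_report_def supplier_utility_set_entry
proof (intro conjI allI impI)
  fix xh :: "real^'n" and gh :: "'g^'n" assume v: "valid_reports \<Gamma> xh gh"
  note v' = valid_set_entry[OF v assms, of i]
  show "xs (set_entry xh i xi) (set_entry gh i \<gamma>i) $ i \<le> xi"
    using procurement_box_nth(2)[OF xs_in_box[OF v'], of i] by simp
  fix a' g'
  assume "0 \<le> a' \<and> g' \<in> \<Gamma> \<and> xs (set_entry xh i a') (set_entry gh i g') $ i \<le> xi"
  then have "xs (set_entry xh i a') (set_entry gh i g') \<in> procurement_box (set_entry xh i xi)"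
    using v by (intro deliverable_in_box) auto
  from S_fun_le_max_surplus[OF v' this]
  show "S_fun r c (xs (set_entry xh i a') (set_entry gh i g')) (set_entry gh i \<gamma>i)
      - h i (remove_entry i xh) (remove_entry i gh)
    \<le> S_fun r c (xs (set_entry xh i xi) (set_entry gh i \<gamma>i)) (set_entry gh i \<gamma>i)
      - h i (remove_entry i xh) (remove_entry i gh)"
    by (simp add: max_surplus_def)
qed (use assms in auto)

text \<open>A dominant report earns no less than truth, hence the allocation it leads to also solves
  the problem with the true data of \<open>i\<close>.\<close>

lemma dominant_attains_true_max:
  assumes dom: "dominant_report r c \<Gamma> xs h i xi \<gamma>i a g" and true: "0 \<le> xi" "\<gamma>i \<in> \<Gamma>"
    and v: "valid_reports \<Gamma> xh gh"
  shows "S_fun r c (xs (set_entry xh i a) (set_entry gh i g)) (set_entry gh i \<gamma>i)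
      = max_surplus (set_entry xh i xi) (set_entry gh i \<gamma>i)"
proof (rule antisym)
  have ag: "0 \<le> a" "g \<in> \<Gamma>" "xs (set_entry xh i a) (set_entry gh i g) $ i \<le> xi"
    using dom v unfolding dominant_report_def by blast+
  show "S_fun r c (xs (set_entry xh i a) (set_entry gh i g)) (set_entry gh i \<gamma>i)
      \<le> max_surplus (set_entry xh i xi) (set_entry gh i \<gamma>i)"
    using v true ag by (intro S_fun_le_max_surplus valid_set_entry deliverable_in_box)
  have "xs (set_entry xh i xi) (set_entry gh i \<gamma>i) $ i \<le> xi"
    using truthful_dominant[OF true, of _ i] v unfolding dominant_report_def by blast
  then have "supplier_utility r c xs h i \<gamma>i (set_entry xh i xi) (set_entry gh i \<gamma>i)
      \<le> supplier_utility r c xs h i \<gamma>i (set_entry xh i a) (set_entry gh i g)"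
    using dom true v unfolding dominant_report_def by blast
  then show "max_surplus (set_entry xh i xi) (set_entry gh i \<gamma>i)
      \<le> S_fun r c (xs (set_entry xh i a) (set_entry gh i g)) (set_entry gh i \<gamma>i)"
    unfolding supplier_utility_set_entry max_surplus_def by simp
qed

section \<open>Scaling down the capacities of the others\<close>

text \<open>This is the part of the surplus shared by the true and the reported problem of
  \<open>i\<close>.\<close>

lemma C1_on_net_of_others:
  assumes "valid_reports \<Gamma> xh gh"
  shows "C1_on {x. 0 \<le> x} (\<lambda>x. r x - (\<Sum>k\<in>-{i}. c (x $ k) (gh $ k)))"
proof (intro C1_on_diff C1_on_sum r_C1)
  fix k
  show "C1_on {x. 0 \<le> x} (\<lambda>x. c (x $ k) (gh $ k))"
    by (rule C1_on_component[OF c_C1]) (use assms in \<open>auto simp: valid_reports_def less_eq_vec_def\<close>)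
qed

text \<open>The capacities of the others are scaled by \<open>s\<close>, from full (\<open>s = 1\<close>) to none (\<open>s = 0\<close>), and
  an allocation is written as \<open>set_entry (s *\<^sub>R u) i (u $ i)\<close>, with \<open>u\<close> in a fixed box.\<close>

lemma max_surplus_difference_scaling:
  assumes dom: "dominant_report r c \<Gamma> xs h i xi \<gamma>i a g" and true: "0 \<le> xi" "\<gamma>i \<in> \<Gamma>"
    and v: "valid_reports \<Gamma> xh gh"
  shows "max_surplus (set_entry xh i xi) (set_entry gh i \<gamma>i) - max_surplus (set_entry xh i a) (set_entry gh i g)
    = max_surplus (set_entry 0 i xi) (set_entry gh i \<gamma>i) - max_surplus (set_entry 0 i a) (set_entry gh i g)"
proof -
  have ag: "0 \<le> a" "g \<in> \<Gamma>"
    using dom unfolding dominant_report_def by blast+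
  have vs: "valid_reports \<Gamma> (s *\<^sub>R xh) gh" if "s \<in> {0..1}" for s
    using v that by (auto simp: valid_reports_def less_eq_vec_def)
  define \<Phi> where "\<Phi> = (\<lambda>x. r x - (\<Sum>k\<in>-{i}. c (x $ k) (gh $ k)))"
  \<comment> \<open>With the minimum as capacity of \<open>i\<close>, points of \<open>K\<close> are
    feasible for both problems.\<close>
  define K where "K = procurement_box (set_entry xh i (min xi a))"
  have S: "S_fun r c x (set_entry gh i g') = \<Phi> x - c (x $ i) g'" for x g'
    by (simp add: S_fun_set_entry \<Phi>_def)
  \<comment> \<open>\<open>P u\<close> keeps entry \<open>i\<close> and \<open>Q u\<close> the
    others, so in \<open>P u + s *\<^sub>R Q u\<close> only the others are scaled.\<close>
  define P where "P = (\<lambda>u. u $ i *\<^sub>R axis i 1 :: real^'n)"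
  define Q where "Q = (\<lambda>u. u - P u)"
  have PQ: "P u + s *\<^sub>R Q u = set_entry (s *\<^sub>R u) i (u $ i)" for u s
    by (auto simp: vec_eq_iff P_def Q_def axis_def)
  define F where "F = (\<lambda>u s. \<Phi> (P u + s *\<^sub>R Q u))"
  define V where "V = (\<lambda>s. max_surplus (set_entry (s *\<^sub>R xh) i xi) (set_entry gh i \<gamma>i))"
  define W where "W = (\<lambda>s. max_surplus (set_entry (s *\<^sub>R xh) i a) (set_entry gh i g))"
  define x where "x = (\<lambda>s. xs (set_entry (s *\<^sub>R xh) i a) (set_entry gh i g))"
  \<comment> \<open>Undoes the scaling of \<open>x s\<close>. At \<open>s = 0\<close> the convention
    \<open>1 / 0 = 0\<close> sets the others to zero, which is also what they supply in
    \<open>x 0\<close>.\<close>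
  define y where "y = (\<lambda>s. set_entry ((1 / s) *\<^sub>R x s) i (x s $ i))"
  have x_box: "x s \<in> procurement_box (set_entry (s *\<^sub>R xh) i a)" if "s \<in> {0..1}" for s
    unfolding x_def using vs[OF that] ag by (intro xs_in_box valid_set_entry)
  have x_le: "x s $ i \<le> xi" if "s \<in> {0..1}" for s
    using dom vs[OF that] unfolding dominant_report_def x_def by blast
  have x_bounds: "0 \<le> x s $ k" "k \<noteq> i \<Longrightarrow> x s $ k \<le> s * xh $ k" "x s $ i \<le> a" if "s \<in> {0..1}" for s k
    using procurement_box_nth[OF x_box[OF that], of k] procurement_box_nth[OF x_box[OF that], of i]
    by auto
  have yK: "y s \<in> K" if s: "s \<in> {0..1}" for s
  proof (cases "s = 0")
    case True
    then show ?thesis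
      using x_bounds[OF s] x_le[OF s] v
      by (auto simp: K_def procurement_box_def y_def less_eq_vec_def valid_reports_def)
  next
    case False
    then show ?thesis
      using x_bounds[OF s] x_le[OF s] s
      by (auto simp: K_def procurement_box_def y_def less_eq_vec_def field_simps)
  qed
  have yx: "P (y s) + s *\<^sub>R Q (y s) = x s" if s: "s \<in> {0..1}" for s
    unfolding PQ using x_bounds[OF s] by (auto simp: vec_eq_iff y_def intro!: antisym)
  have box: "P u + s *\<^sub>R Q u \<in> procurement_box (set_entry (s *\<^sub>R xh) i b)"
    if "u \<in> K" "s \<in> {0..1}" "b \<in> {xi, a}" for u s b
  proof -
    have "0 \<le> u $ k" "k \<noteq> i \<Longrightarrow> u $ k \<le> xh $ k" "u $ i \<le> xi" "u $ i \<le> a" for k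
      using procurement_box_nth[OF that(1)[unfolded K_def], of k]
        procurement_box_nth[OF that(1)[unfolded K_def], of i] by auto
    then show ?thesis
      unfolding PQ using that by (auto simp: procurement_box_def less_eq_vec_def intro!: mult_left_mono)
  qed
  have y_i: "y s $ i = x s $ i" and x_eq: "xs (set_entry (s *\<^sub>R xh) i a) (set_entry gh i g) = x s" for s
    by (simp_all add: y_def x_def)
  \<comment> \<open>Dominance enters here: \<open>x s\<close>, chosen for the reported problem,
    attains the true maximum \<open>V s\<close> too.\<close>
  have V_eq: "V s = F (y s) s - c (y s $ i) \<gamma>i" if "s \<in> {0..1}" for s
    using dominant_attains_true_max[OF dom true vs[OF that]] yx[OF that]
    by (simp add: V_def S F_def y_i x_eq)
  have W_eq: "W s = F (y s) s - c (y s $ i) g" if "s \<in> {0..1}" for s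
    using yx[OF that] by (simp add: W_def max_surplus_def S F_def y_i x_eq)
  have comp: "(P u + s *\<^sub>R Q u) $ i = u $ i" for u s
    by (simp add: PQ)
  \<comment> \<open>A fixed \<open>u\<close> remains feasible at every \<open>s\<close>, with a cost
    of \<open>i\<close> that does not vary with \<open>s\<close>; hence only \<open>F\<close>
    changes along the path.\<close>
  have V_ge: "F u s - c (u $ i) \<gamma>i \<le> V s" if "u \<in> K" "s \<in> {0..1}" for u s
    using S_fun_le_max_surplus[OF valid_set_entry[OF vs[OF that(2)] true, of i] box[OF that, of xi]]
    unfolding V_def S F_def comp by simp
  have W_ge: "F u s - c (u $ i) g \<le> W s" if "u \<in> K" "s \<in> {0..1}" for u s
    using S_fun_le_max_surplus[OF valid_set_entry[OF vs[OF that(2)] ag, of i] box[OF that, of a]]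
    unfolding W_def S F_def comp by simp
  have K: "compact K"
  proof -
    have "K = cbox 0 (set_entry xh i (min xi a))"
      by (auto simp: K_def procurement_box_def cbox_def less_eq_vec_def Basis_vec_def inner_axis)
    then show ?thesis by (simp add: compact_cbox)
  qed
  have P: "continuous_on K P"
    unfolding P_def by (intro continuous_intros)
  have Q: "continuous_on K Q"
    unfolding Q_def by (intro continuous_intros P)
  have "0 \<le> P u + s *\<^sub>R Q u" if "u \<in> K" "s \<in> {0..1}" for u s
    using box[OF that] by (auto simp: procurement_box_def)
  then obtain F' where F': "continuous_on (K \<times> {0..1}) (\<lambda>z. F' (fst z) (snd z))"
    "\<And>u s. u \<in> K \<Longrightarrow> s \<in> {0..1} \<Longrightarrow> (F u has_real_derivative F' u s) (at s within {0..1})"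
    using C1_on_orthant_line[OF C1_on_net_of_others[OF v, of i, folded \<Phi>_def] P Q]
    unfolding F_def by blast
  have "V 1 - W 1 = V 0 - W 0"
  proof (rule envelope_difference_constant[OF K F' yK])
    fix s s' :: real assume s: "s \<in> {0..1}" "s' \<in> {0..1}"
    show "V s + F (y s) s' - F (y s) s \<le> V s'"
      using V_eq[OF s(1)] V_ge[OF yK[OF s(1)] s(2)] by linarith
    show "W s + F (y s) s' - F (y s) s \<le> W s'"
      using W_eq[OF s(1)] W_ge[OF yK[OF s(1)] s(2)] by linarith
  qed
  then show ?thesis
    by (simp add: V_def W_def)
qed

text \<open>Without capacity the others supply zero at zero cost, whatever their types.\<close>

lemma max_surplus_alone:
  assumes "valid_reports \<Gamma> (set_entry 0 i a) gh" "valid_reports \<Gamma> (set_entry 0 i a) gh'"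
    and "gh $ i = gh' $ i"
  shows "max_surplus (set_entry 0 i a) gh = max_surplus (set_entry 0 i a) gh'"
proof -
  have S: "S_fun r c x gh = S_fun r c x gh'" if "x \<in> procurement_box (set_entry 0 i a)" for x
  proof -
    have "x $ k = 0" if "k \<noteq> i" for k
      using procurement_box_nth[OF \<open>x \<in> _\<close>, of k] that by simp
    then have "c (x $ k) (gh $ k) = c (x $ k) (gh' $ k)" for k
      using assms c_zero by (cases "k = i") (auto simp: valid_reports_def)
    then show ?thesis
      by (simp add: S_fun_def)
  qed
  show ?thesis
    using S_fun_le_max_surplus[OF assms(1) xs_in_box[OF assms(2)]]
      S_fun_le_max_surplus[OF assms(2) xs_in_box[OF assms(1)]]
      S[OF xs_in_box[OF assms(1)]] S[OF xs_in_box[OF assms(2)]]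
    by (simp add: max_surplus_def)
qed

text \<open>After scaling to zero only the data of \<open>i\<close> matter; \<open>vec\<close>
  supplies a fixed valid type profile for the others, so \<open>K\<close> depends on neither
  \<open>xh\<close> nor \<open>gh\<close>.\<close>

lemma max_surplus_difference_constant:
  assumes dom: "dominant_report r c \<Gamma> xs h i xi \<gamma>i a g" and true: "0 \<le> xi" "\<gamma>i \<in> \<Gamma>"
  obtains K where "\<And>xh gh. valid_reports \<Gamma> xh gh \<Longrightarrow>
    max_surplus (set_entry xh i xi) (set_entry gh i \<gamma>i)
      = max_surplus (set_entry xh i a) (set_entry gh i g) + K"
proof
  fix xh :: "real^'n" and gh :: "'g^'n" assume v: "valid_reports \<Gamma> xh gh"
  have ag: "0 \<le> a" "g \<in> \<Gamma>"
    using dom unfolding dominant_report_def by blast+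
  have alone: "max_surplus (set_entry 0 i b) (set_entry gh i g') = max_surplus (set_entry 0 i b) (vec g')"
    if "0 \<le> b" "g' \<in> \<Gamma>" for b g'
    by (rule max_surplus_alone) (use v that in \<open>auto simp: valid_reports_def less_eq_vec_def\<close>)
  show "max_surplus (set_entry xh i xi) (set_entry gh i \<gamma>i)
      = max_surplus (set_entry xh i a) (set_entry gh i g)
        + (max_surplus (set_entry 0 i xi) (vec \<gamma>i) - max_surplus (set_entry 0 i a) (vec g))"
    using max_surplus_difference_scaling[OF dom true v] alone[OF true] alone[OF ag] by linarith
qed

section \<open>From one supplier to all of them\<close>

text \<open>Both sides of the equation exceed the reported surplus at \<open>xs xh gh\<close> by the
  sum of all \<open>K i\<close>.\<close>

lemma induced_allocation_optimal:
  assumes ind: "induced_reports r c \<Gamma> xs h xbar \<gamma> xh gh"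
    and true: "valid_reports \<Gamma> xbar \<gamma>"
  shows "xs xh gh \<in> procurement_box xbar" "S_fun r c (xs xh gh) \<gamma> = max_surplus xbar \<gamma>"
proof -
  have dom: "dominant_report r c \<Gamma> xs h i (xbar $ i) (\<gamma> $ i) (xh $ i) (gh $ i)" for i
    using ind unfolding induced_reports_def by blast
  have ti: "0 \<le> xbar $ i" "\<gamma> $ i \<in> \<Gamma>" for i
    using true by (auto simp: valid_reports_def less_eq_vec_def)
  have ri: "0 \<le> xh $ i" "gh $ i \<in> \<Gamma>" for i
    using dom[of i] unfolding dominant_report_def by blast+
  then have v: "valid_reports \<Gamma> xh gh"
    by (auto simp: valid_reports_def less_eq_vec_def)
  have "xs xh gh $ i \<le> xbar $ i" for i
  proof -
    have "xs (set_entry xh i (xh $ i)) (set_entry gh i (gh $ i)) $ i \<le> xbar $ i"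
      using dom[of i] v unfolding dominant_report_def by blast
    then show ?thesis by simp
  qed
  then show "xs xh gh \<in> procurement_box xbar"
    using xs_in_box[OF v] by (auto simp: procurement_box_def less_eq_vec_def)
  have "\<exists>K. \<forall>xh' gh'. valid_reports \<Gamma> xh' gh' \<longrightarrow>
      max_surplus (set_entry xh' i (xbar $ i)) (set_entry gh' i (\<gamma> $ i))
        = max_surplus (set_entry xh' i (xh $ i)) (set_entry gh' i (gh $ i)) + K" for i
    using max_surplus_difference_constant[OF dom ti] by metis
  then obtain K where K: "\<And>i xh' gh'. valid_reports \<Gamma> xh' gh' \<Longrightarrow>
      max_surplus (set_entry xh' i (xbar $ i)) (set_entry gh' i (\<gamma> $ i))
        = max_surplus (set_entry xh' i (xh $ i)) (set_entry gh' i (gh $ i)) + K i"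
    by metis
  \<comment> \<open>Evaluating the constant at the actual reports identifies \<open>K i\<close> as
    the overstatement of cost at the chosen allocation.\<close>
  have cost: "c (xs xh gh $ i) (gh $ i) = c (xs xh gh $ i) (\<gamma> $ i) + K i" for i
  proof -
    have "S_fun r c (xs xh gh) (set_entry gh i (\<gamma> $ i)) = max_surplus xh gh + K i"
      using dominant_attains_true_max[OF dom ti v, of i] K[OF v, of i] by simp
    then have "S_fun r c (xs xh gh) (set_entry gh i (\<gamma> $ i))
        = S_fun r c (xs xh gh) (set_entry gh i (gh $ i)) + K i"
      by (simp add: max_surplus_def)
    then show ?thesis
      unfolding S_fun_set_entry by linarith
  qed
  \<comment> \<open>Hybrid profiles: suppliers in \<open>I\<close> enter with their reports, the
    rest with the truth.\<close>
  define mx where "mx = (\<lambda>I. \<chi> k. if k \<in> I then xh $ k else xbar $ k)"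
  define mg where "mg = (\<lambda>I. \<chi> k. if k \<in> I then gh $ k else \<gamma> $ k)"
  have "max_surplus xbar \<gamma> = max_surplus (mx I) (mg I) + (\<Sum>i\<in>I. K i)" for I
  proof (induction I rule: finite_induct[OF finite])
    case 1
    then show ?case by (simp add: mx_def mg_def)
  next
    case (2 i I)
    \<comment> \<open>Hybrids are valid reports, and \<open>K i\<close> is the same at all of these,
      so each exchange costs exactly \<open>K i\<close>.\<close>
    have "valid_reports \<Gamma> (mx I) (mg I)"
      using ti ri by (auto simp: valid_reports_def less_eq_vec_def mx_def mg_def)
    moreover have "set_entry (mx I) i (xbar $ i) = mx I" "set_entry (mg I) i (\<gamma> $ i) = mg I"
      using 2 by (auto simp: vec_eq_iff mx_def mg_def)
    moreover have "set_entry (mx I) i (xh $ i) = mx (insert i I)"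
      "set_entry (mg I) i (gh $ i) = mg (insert i I)"
      by (auto simp: vec_eq_iff mx_def mg_def)
    ultimately have "max_surplus (mx I) (mg I) = max_surplus (mx (insert i I)) (mg (insert i I)) + K i"
      using K[of "mx I" "mg I" i] by simp
    then show ?case
      using 2 by simp
  qed
  from this[of UNIV] have "max_surplus xbar \<gamma> = S_fun r c (xs xh gh) gh + (\<Sum>i\<in>UNIV. K i)"
    by (simp add: mx_def mg_def max_surplus_def)
  then show "S_fun r c (xs xh gh) \<gamma> = max_surplus xbar \<gamma>"
    by (simp add: S_fun_def cost sum.distrib)
qed

end

section \<open>Combination with the demand side\<close>

text \<open>Dominant reports may be untruthful, so optimality is claimed for every induced profile;
  the first conjunct shows that such profiles exist.\<close>

theorem proposition2:
  fixes r :: "real^'n \<Rightarrow> real"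
    and c :: "real \<Rightarrow> 'g \<Rightarrow> real" and \<Gamma> :: "'g set"
    and v :: "real^'n \<Rightarrow> 't \<Rightarrow> real"
    and prior :: "('m::finite \<Rightarrow> 't) pmf"
    and t :: "real^'n \<Rightarrow> ('m \<Rightarrow> 't) \<Rightarrow> 'm \<Rightarrow> real"
    and R :: "real^'n \<Rightarrow> ('m \<Rightarrow> 't) \<Rightarrow> real"
    and xs :: "real^'n \<Rightarrow> 'g^'n \<Rightarrow> real^'n"
    and h :: "'n \<Rightarrow> ('n \<Rightarrow> real) \<Rightarrow> ('n \<Rightarrow> 'g) \<Rightarrow> real"
    and xbar :: "real^'n" and \<gamma> :: "'g^'n" and \<theta> :: "'m \<Rightarrow> 't"
  assumes r_smooth: "smooth_on {x. 0 \<le> x} r"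
    and r_mono: "mono_on {x. 0 \<le> x} r"
    and r_zero: "r 0 = 0"
    and c_smooth: "\<And>g. g \<in> \<Gamma> \<Longrightarrow> smooth_on {0..} (\<lambda>y. c y g)"
    and c_mono: "\<And>g. g \<in> \<Gamma> \<Longrightarrow> mono_on {0..} (\<lambda>y. c y g)"
    and c_zero: "\<And>g. g \<in> \<Gamma> \<Longrightarrow> c 0 g = 0"
    and prior: "cremer_mclean_condition prior"
    and demand_side: "cremer_mclean_mechanism prior v t R"
    and val_types: "\<theta> \<in> val_profiles prior"
    and revenue: "\<And>x. 0 \<le> x \<Longrightarrow> r x = R x \<theta>"
    and capacities: "0 \<le> xbar"
    and cost_types: "\<And>i. \<gamma> $ i \<in> \<Gamma>"
    and allocation: "allocation_rule r c \<Gamma> xs"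
  shows "induced_reports r c \<Gamma> xs h xbar \<gamma> xbar \<gamma> \<and>
    (\<forall>xh gh. induced_reports r c \<Gamma> xs h xbar \<gamma> xh gh \<longrightarrow>
       (0 \<le> xs xh gh \<and> xs xh gh \<le> xbar) \<and>
       (\<forall>x. 0 \<le> x \<and> x \<le> xbar \<longrightarrow>
          social_surplus v c \<theta> \<gamma> (xs xh gh) \<ge> social_surplus v c \<theta> \<gamma> x))"
proof -
  interpret procurement r c \<Gamma> xs
    using r_smooth c_smooth c_zero allocation by unfold_locales (auto intro: smooth_on_imp_C1_on)
  have true: "valid_reports \<Gamma> xbar \<gamma>"
    using capacities cost_types by (simp add: valid_reports_def)
  \<comment> \<open>Budget balance and full extraction turn revenue into total valuation at the true
    \<open>\<theta>\<close>.\<close>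
  have surplus: "social_surplus v c \<theta> \<gamma> x = S_fun r c x \<gamma>" if "0 \<le> x" for x
    using demand_side val_types revenue[OF that] that
    by (simp add: social_surplus_def S_fun_def cremer_mclean_mechanism_def
        ex_post_budget_balanced_def extracts_full_surplus_def)
  have "induced_reports r c \<Gamma> xs h xbar \<gamma> xbar \<gamma>"
    unfolding induced_reports_def
    using capacities cost_types by (auto simp: less_eq_vec_def intro!: truthful_dominant)
  moreover have "(0 \<le> xs xh gh \<and> xs xh gh \<le> xbar) \<and>
      (\<forall>x. 0 \<le> x \<and> x \<le> xbar \<longrightarrow> social_surplus v c \<theta> \<gamma> (xs xh gh) \<ge> social_surplus v c \<theta> \<gamma> x)"
    if "induced_reports r c \<Gamma> xs h xbar \<gamma> xh gh" for xh gh
    using induced_allocation_optimal[OF that true] S_fun_le_max_surplus[OF true]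
    by (auto simp: procurement_box_def surplus)
  ultimately show ?thesis
    by blast
qed

end
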